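(* Let $A$ be a totally ordered alphabet, let $w$ be a nonempty finite word over $A$, and let $w=\ell_1\ell_2\cdots\ell_n$ be its factorization into Lyndon words with $\ell_1\ge\ell_2\ge\cdots\ge\ell_n$ (this factorization exists and is unique). Then: 1. $\ell_1$ is the shortest nonempty prefix $p$ of $w$ such that, writing $w=ps$, one has either $s$ empty or $p^\omega\ge s^\omega$; 2. $\ell_1$ is the shortest nonempty prefix $p$ of $w$ such that $p^\omega\ge w^\omega$.
   Context: The order $<$ on finite and infinite words is the lexicographical order induced by the order of $A$: $s<t$ if either $s$ is a proper prefix of $t$, or $s=pas'$, $t=pbt'$ with $p$ finite, $a,b$ letters with $a<b$. For a nonempty finite word $x$, $x^\omega=xxx\cdots$. A nonempty word $w$ is a Lyndon word if for every factorization $w=uv$ with $u,v$ nonempty one has $w<v$. *)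

theory Defs
  imports
    Main
    "HOL-Library.List_Lexorder"
    "HOL-Library.Fun_Lexorder"
    "HOL-Library.Omega_Words_Fun"
begin

text \<open>
  The totally ordered alphabet is a type of class \<^class>\<open>linorder\<close>. The order on finite words is the
  instance from \<^theory>\<open>HOL-Library.List_Lexorder\<close>, in which a proper prefix is smaller; the strict
  order on infinite words is \<^const>\<open>less_fun\<close>.
\<close>

lemma list_less_iff:
  fixes s t :: "'a::linorder list"
  shows "s < t \<longleftrightarrow> (\<exists>v. v \<noteq> [] \<and> t = s @ v) \<or>
    (\<exists>p a b s' t'. a < b \<and> s = p @ a # s' \<and> t = p @ b # t')"
  unfolding list_less_def lexord_def by (auto simp: neq_Nil_conv)

lemma less_fun_omega_iff:
  fixes s t :: "'a::linorder word"
  shows "less_fun s t \<longleftrightarrow>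
    (\<exists>p a b s' t'. a < b \<and> s = (p @ [a]) \<frown> s' \<and> t = (p @ [b]) \<frown> t')"
proof
  assume "less_fun s t"
  then obtain k where k: "s k < t k" "\<And>i. i < k \<Longrightarrow> s i = t i"
    by (rule less_funE) blast
  define p where "p = map s [0..<k]"
  have "s = (p @ [s k]) \<frown> (\<lambda>n. s (n + Suc k))" "t = (p @ [t k]) \<frown> (\<lambda>n. t (n + Suc k))"
    using k by (auto simp: fun_eq_iff conc_def p_def nth_append less_Suc_eq)
  with k show "\<exists>p a b s' t'. a < b \<and> s = (p @ [a]) \<frown> s' \<and> t = (p @ [b]) \<frown> t'"
    by blast
next
  assume "\<exists>p a b s' t'. a < b \<and> s = (p @ [a]) \<frown> s' \<and> t = (p @ [b]) \<frown> t'"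
  then obtain p a b s' t' where *: "a < b" "s = (p @ [a]) \<frown> s'" "t = (p @ [b]) \<frown> t'"
    by blast
  then have "s (length p) < t (length p) \<and> (\<forall>i<length p. s i = t i)"
    by (simp add: conc_def nth_append)
  then show "less_fun s t"
    by (auto simp: less_fun_def)
qed

definition omega_le :: "'a::linorder word \<Rightarrow> 'a word \<Rightarrow> bool"
  where "omega_le s t \<longleftrightarrow> s = t \<or> less_fun s t"

definition lyndon :: "'a::linorder list \<Rightarrow> bool"
  where "lyndon w \<longleftrightarrow> w \<noteq> [] \<and> (\<forall>u v. w = u @ v \<and> u \<noteq> [] \<and> v \<noteq> [] \<longrightarrow> w < v)"

definition lyndon_factorization :: "'a::linorder list \<Rightarrow> 'a list list \<Rightarrow> bool"
  where "lyndon_factorization w ls \<longleftrightarrow>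
    concat ls = w \<and> (\<forall>l\<in>set ls. lyndon l) \<and> sorted_wrt (\<ge>) ls"

text \<open>
  Two prefixes of the same word having equal length coincide, so a prefix of minimal length is
  the shortest one.
\<close>

definition shortest_prefix :: "'a list \<Rightarrow> ('a list \<Rightarrow> 'a list \<Rightarrow> bool) \<Rightarrow> 'a list \<Rightarrow> bool"
  where "shortest_prefix w P =
    is_arg_min length (\<lambda>p. p \<noteq> [] \<and> (\<exists>s. w = p @ s \<and> P p s))"

end

theory Submission
  imports Defs
begin

text \<open>
  For nonempty words, comparing \<open>u\<^sup>\<omega>\<close> with \<open>v\<^sup>\<omega>\<close> amounts to comparing \<open>uv\<close> with \<open>vu\<close>.
  For \<open>w = ps\<close> the conditions \<open>p\<^sup>\<omega> \<ge> s\<^sup>\<omega>\<close> and \<open>p\<^sup>\<omega> \<ge> w\<^sup>\<omega>\<close> become \<open>sp \<le> ps\<close> and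
  \<open>psp \<le> pps\<close>, so they are equivalent. The first Lyndon factor satisfies them because it
  can be moved to the right across the other factors, each exchange making the word no larger;
  a proper prefix \<open>p\<close> of \<open>\<ell>\<^sub>1 = pq\<close> violates them because \<open>\<ell>\<^sub>1 < q\<close> is decided at a letter.
  Since this determines \<open>\<ell>\<^sub>1\<close>, uniqueness of the factorization follows as well.
\<close>

section \<open>Lexicographic order and concatenation\<close>

lemma append_less_append_cancel [simp]:
  fixes x y :: "'a::linorder list"
  shows "p @ x < p @ y \<longleftrightarrow> x < y"
  by (induction p) auto

lemma append_le_append_cancel [simp]:
  fixes x y :: "'a::linorder list"
  shows "p @ x \<le> p @ y \<longleftrightarrow> x \<le> y"
  by (simp add: le_less)

lemma less_append_self:
  fixes x :: "'a::linorder list"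
  assumes "v \<noteq> []"
  shows "x < x @ v"
  using assms by (auto simp: list_less_iff)

text \<open>The length bound excludes a proper prefix, so the comparison is decided at a letter and
  survives any right extension of either side.\<close>

lemma less_letterE:
  fixes x y :: "'a::linorder list"
  assumes "x < y" "length y \<le> length x"
  obtains p a b s t where "a < b" "x = p @ a # s" "y = p @ b # t"
proof -
  have "\<not> (\<exists>v. v \<noteq> [] \<and> y = x @ v)"
    using assms(2) by auto
  with assms(1) that show thesis
    unfolding list_less_iff by blast
qed

lemma less_imp_append_less_append:
  fixes x y :: "'a::linorder list"
  assumes "x < y" "length y \<le> length x"
  shows "x @ s < y @ t"
  using assms by (elim less_letterE) auto

lemma less_fun_conc:
  fixes x y :: "'a::linorder list"
  assumes "x < y" "length y \<le> length x"
  shows "less_fun (x \<frown> s) (y \<frown> t)"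
proof -
  obtain p a b s' t' where *: "a < b" "x = p @ a # s'" "y = p @ b # t'"
    using assms by (rule less_letterE)
  then have "x \<frown> s = (p @ [a]) \<frown> (s' \<frown> s)" "y \<frown> t = (p @ [b]) \<frown> (t' \<frown> t)"
    by (simp_all flip: conc_conc)
  with \<open>a < b\<close> show ?thesis
    unfolding less_fun_omega_iff by blast
qed

section \<open>Comparing infinite powers\<close>

text \<open>Prepending a nonempty word shifts by at least one position, so agreement strictly below
  \<open>k\<close> becomes agreement up to and including \<open>k\<close>.\<close>

lemma conc_nth_cong:
  assumes "x \<noteq> []" "\<And>i. i < k \<Longrightarrow> s i = t i" "i \<le> k"
  shows "(x \<frown> s) i = (x \<frown> t) i"
  using assms by (cases x) (auto simp: conc_def)

lemma iter_conc:
  assumes "x \<noteq> []"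
  shows "x \<frown> x\<^sup>\<omega> = x\<^sup>\<omega>"
  using assms iter_unroll by fastforce

lemma first_difference:
  fixes s t :: "nat \<Rightarrow> 'a"
  assumes "s \<noteq> t"
  obtains k where "s k \<noteq> t k" "\<And>i. i < k \<Longrightarrow> s i = t i"
  using assms exists_least_iff[of "\<lambda>k. s k \<noteq> t k"] by (auto simp: fun_eq_iff)

text \<open>Prepending \<open>x\<close> is a contraction: at a first difference \<open>k\<close>
  from \<open>x\<^sup>\<omega>\<close>, one more application would force agreement at
  \<open>k\<close> too.\<close>

lemma conc_fixpoint_eq_iter:
  assumes "x \<noteq> []" "x \<frown> z = z"
  shows "z = x\<^sup>\<omega>"
proof (rule ccontr)
  assume "z \<noteq> x\<^sup>\<omega>"
  then obtain k where k: "z k \<noteq> (x\<^sup>\<omega>) k" "\<And>i. i < k \<Longrightarrow> z i = (x\<^sup>\<omega>) i"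
    by (rule first_difference) blast
  then have "(x \<frown> z) k = (x \<frown> x\<^sup>\<omega>) k"
    using assms(1) by (intro conc_nth_cong[where k = k]) auto
  with k(1) assms show False
    by (simp add: iter_conc)
qed

text \<open>At the first position where \<open>z\<close> leaves \<open>x\<^sup>\<omega>\<close>, the
  word \<open>x \<frown> z\<close> still follows \<open>x\<^sup>\<omega>\<close>. Hence
  \<open>z\<close> compares with \<open>x \<frown> z\<close> as it does with
  \<open>x\<^sup>\<omega>\<close>.\<close>

lemma conc_vs_iter:
  assumes "x \<noteq> []" "z \<noteq> x\<^sup>\<omega>"
  obtains k where "z k \<noteq> (x\<^sup>\<omega>) k" "\<And>i. i < k \<Longrightarrow> z i = (x\<^sup>\<omega>) i"
    "\<And>i. i \<le> k \<Longrightarrow> (x \<frown> z) i = (x\<^sup>\<omega>) i"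
proof -
  obtain k where k: "z k \<noteq> (x\<^sup>\<omega>) k" "\<And>i. i < k \<Longrightarrow> z i = (x\<^sup>\<omega>) i"
    using assms(2) by (rule first_difference) blast
  have "(x \<frown> z) i = (x\<^sup>\<omega>) i" if "i \<le> k" for i
    using conc_nth_cong[OF assms(1) k(2) that] iter_conc[OF assms(1)] by simp
  with k that show thesis
    by blast
qed

lemma less_fun_at_first_difference:
  fixes s t :: "'a::linorder word"
  assumes "less_fun s t" "\<And>i. i < k \<Longrightarrow> s i = t i" "s k \<noteq> t k"
  shows "s k < t k"
proof -
  obtain j where j: "s j < t j" "\<And>i. i < j \<Longrightarrow> s i = t i"
    using assms(1) by (rule less_funE) blast
  then have "j = k"
    using assms(2,3) by (metis less_irrefl linorder_neqE_nat)
  with j show ?thesis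
    by simp
qed

lemma iter_less_if_conc_less:
  fixes z :: "'a::linorder word"
  assumes "x \<noteq> []" "less_fun (x \<frown> z) z"
  shows "less_fun (x\<^sup>\<omega>) z"
proof -
  have "z \<noteq> x\<^sup>\<omega>"
    using assms by (auto simp: iter_conc less_fun_irrefl)
  with assms(1) obtain k where k: "z k \<noteq> (x\<^sup>\<omega>) k" "\<And>i. i < k \<Longrightarrow> z i = (x\<^sup>\<omega>) i"
    "\<And>i. i \<le> k \<Longrightarrow> (x \<frown> z) i = (x\<^sup>\<omega>) i"
    by (rule conc_vs_iter) blast
  then have "(x \<frown> z) k < z k"
    using less_fun_at_first_difference[OF assms(2), of k] by simp
  with k show ?thesis
    by (auto simp: less_fun_def)
qed

lemma less_iter_if_less_conc:
  fixes z :: "'a::linorder word"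
  assumes "x \<noteq> []" "less_fun z (x \<frown> z)"
  shows "less_fun z (x\<^sup>\<omega>)"
proof -
  have "z \<noteq> x\<^sup>\<omega>"
    using assms by (auto simp: iter_conc less_fun_irrefl)
  with assms(1) obtain k where k: "z k \<noteq> (x\<^sup>\<omega>) k" "\<And>i. i < k \<Longrightarrow> z i = (x\<^sup>\<omega>) i"
    "\<And>i. i \<le> k \<Longrightarrow> (x \<frown> z) i = (x\<^sup>\<omega>) i"
    by (rule conc_vs_iter) blast
  then have "z k < (x \<frown> z) k"
    using less_fun_at_first_difference[OF assms(2), of k] by simp
  with k show ?thesis
    by (auto simp: less_fun_def)
qed

lemma iter_eq_if_commute:
  assumes "u \<noteq> []" "v \<noteq> []" "u @ v = v @ u"
  shows "u\<^sup>\<omega> = v\<^sup>\<omega>"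
proof -
  have "v \<frown> (u \<frown> v\<^sup>\<omega>) = u \<frown> (v \<frown> v\<^sup>\<omega>)"
    using assms(3) by (simp add: conc_conc)
  then have "v \<frown> (u \<frown> v\<^sup>\<omega>) = u \<frown> v\<^sup>\<omega>"
    using assms(2) by (simp add: iter_conc)
  \<comment> \<open>Both words are fixed by prepending \<open>v\<close>; the result says that
    \<open>v\<^sup>\<omega>\<close> is fixed by prepending \<open>u\<close>.\<close>
  then have "u \<frown> v\<^sup>\<omega> = v\<^sup>\<omega>"
    using assms(2) by (intro conc_fixpoint_eq_iter)
  then show ?thesis
    using assms(1) conc_fixpoint_eq_iter by metis
qed

lemma iter_less_if_append_less:
  fixes u v :: "'a::linorder list"
  assumes "u \<noteq> []" "v \<noteq> []" "u @ v < v @ u"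
  shows "less_fun (u\<^sup>\<omega>) (v\<^sup>\<omega>)"
proof -
  \<comment> \<open>The tail \<open>u\<^sup>\<omega>\<close> absorbs the last \<open>u\<close> on
    the right, so \<open>z = v \<frown> u\<^sup>\<omega>\<close> satisfies
    \<open>u \<frown> z < z\<close>.\<close>
  have "less_fun ((u @ v) \<frown> u\<^sup>\<omega>) ((v @ u) \<frown> u\<^sup>\<omega>)"
    using assms(3) by (intro less_fun_conc) auto
  then have "less_fun (u \<frown> (v \<frown> u\<^sup>\<omega>)) (v \<frown> u\<^sup>\<omega>)"
    using assms(1) by (simp add: iter_conc flip: conc_conc)
  with assms(1) have "less_fun (u\<^sup>\<omega>) (v \<frown> u\<^sup>\<omega>)"
    by (rule iter_less_if_conc_less)
  with assms(2) show ?thesis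
    by (rule less_iter_if_less_conc)
qed

lemma omega_le_iter_iff:
  fixes u v :: "'a::linorder list"
  assumes "u \<noteq> []" "v \<noteq> []"
  shows "omega_le (u\<^sup>\<omega>) (v\<^sup>\<omega>) \<longleftrightarrow> u @ v \<le> v @ u"
proof (cases "u @ v" "v @ u" rule: linorder_cases)
  case less
  with iter_less_if_append_less[OF assms] show ?thesis
    by (simp add: omega_le_def)
next
  case equal
  with iter_eq_if_commute[OF assms] show ?thesis
    by (simp add: omega_le_def)
next
  case greater
  then have "less_fun (v\<^sup>\<omega>) (u\<^sup>\<omega>)"
    using assms by (intro iter_less_if_append_less)
  then have "\<not> omega_le (u\<^sup>\<omega>) (v\<^sup>\<omega>)"
    by (auto simp: omega_le_def less_fun_irrefl dest: less_fun_asym)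
  with greater show ?thesis
    by simp
qed

section \<open>Lyndon words\<close>

text \<open>If \<open>v = u @ v'\<close>, the Lyndon property gives \<open>v < v'\<close>, and
  \<open>u\<close> is put in front of both; otherwise a letter decides \<open>u < v\<close>.\<close>

lemma lyndon_append_less:
  fixes u v :: "'a::linorder list"
  assumes "lyndon v" "u \<noteq> []" "u < v"
  shows "u @ v < v"
proof (cases "\<exists>v'. v' \<noteq> [] \<and> v = u @ v'")
  case True
  then obtain v' where v': "v' \<noteq> []" "v = u @ v'"
    by blast
  with assms have "v < v'"
    by (auto simp: lyndon_def)
  then have "u @ v < u @ v'"
    by simp
  with v' show ?thesis
    by simp
next
  case False
  with assms(3) obtain p a b s t where *: "a < b" "u = p @ a # s" "v = p @ b # t"
    unfolding list_less_iff by blast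
  show ?thesis
    unfolding *(2,3) using *(1) by simp
qed

text \<open>A proper suffix that starts inside \<open>u\<close> is \<open>z @ v\<close> with
  \<open>u < z\<close> decided at a letter, as \<open>z\<close> is shorter. Every other one is
  \<open>v\<close> or a proper suffix of \<open>v\<close>, hence at least \<open>v\<close>, and
  \<open>u @ v < v\<close>.\<close>

lemma lyndon_append:
  fixes u v :: "'a::linorder list"
  assumes "lyndon u" "lyndon v" "u < v"
  shows "lyndon (u @ v)"
proof -
  have "u \<noteq> []"
    using assms(1) by (simp add: lyndon_def)
  have uv: "u @ v < v"
    using assms(2) \<open>u \<noteq> []\<close> assms(3) by (rule lyndon_append_less)
  have "u @ v < y" if xy: "u @ v = x @ y" "x \<noteq> []" "y \<noteq> []" for x y
  proof -
    obtain z where "u = x @ z \<and> z @ v = y \<or> u @ z = x \<and> v = z @ y"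
      using xy(1) unfolding append_eq_append_conv2 by blast
    then show ?thesis
    proof (elim disjE conjE)
      assume z: "u = x @ z" "z @ v = y"
      show ?thesis
      proof (cases "z = []")
        case True
        with uv z show ?thesis
          by simp
      next
        case False
        with assms(1) z xy(2) have "u < z"
          by (auto simp: lyndon_def)
        then have "u @ v < z @ v"
          using z by (intro less_imp_append_less_append) auto
        with z show ?thesis
          by simp
      qed
    next
      assume z: "u @ z = x" "v = z @ y"
      show ?thesis
      proof (cases "z = []")
        case True
        with uv z show ?thesis
          by simp
      next
        case False
        with assms(2) z xy(3) have "v < y"
          by (auto simp: lyndon_def)
        with uv show ?thesis
          by (rule less_trans)
      qed
    qed
  qed
  with \<open>u \<noteq> []\<close> show ?thesis
    by (auto simp: lyndon_def)
qed

lemma lyndon_append_le_swap: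
  fixes u v :: "'a::linorder list"
  assumes "lyndon u" "lyndon v" "u \<le> v"
  shows "u @ v \<le> v @ u"
proof (cases "u = v")
  case False
  then have "u @ v < v"
    using assms by (intro lyndon_append_less) (auto simp: lyndon_def)
  also have "v < v @ u"
    using assms(1) by (intro less_append_self) (simp add: lyndon_def)
  finally show ?thesis
    by simp
qed simp

section \<open>Existence of the factorization\<close>

lemma lyndon_factorization_Nil [simp]: "lyndon_factorization w [] \<longleftrightarrow> w = []"
  by (auto simp: lyndon_factorization_def)

lemma lyndon_factorization_Cons:
  "lyndon_factorization w (l # ls) \<longleftrightarrow>
    lyndon l \<and> (\<forall>m\<in>set ls. m \<le> l) \<and> (\<exists>s. w = l @ s \<and> lyndon_factorization s ls)"
  by (auto simp: lyndon_factorization_def)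

text \<open>As long as \<open>l\<close> is smaller than the next factor the two merge into one
  Lyndon word, which is then inserted in turn; hence the induction generalizes over
  \<open>l\<close>.\<close>

lemma lyndon_factorization_insert:
  fixes l :: "'a::linorder list"
  assumes "lyndon l" "lyndon_factorization s ls"
  shows "\<exists>ls'. lyndon_factorization (l @ s) ls'"
  using assms
proof (induction ls arbitrary: l s)
  case Nil
  then have "lyndon_factorization (l @ s) [l]"
    by (simp add: lyndon_factorization_Cons)
  then show ?case
    by blast
next
  case (Cons m ms)
  then obtain t where t: "s = m @ t" "lyndon_factorization t ms" "lyndon m" "\<forall>n\<in>set ms. n \<le> m"
    by (auto simp: lyndon_factorization_Cons)
  show ?case
  proof (cases "l < m")
    case True
    with Cons.prems(1) t(3) have "lyndon (l @ m)"
      by (rule lyndon_append)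
    from Cons.IH[OF this t(2)] t(1) show ?thesis
      by simp
  next
    case False
    then have "\<forall>n\<in>set (m # ms). n \<le> l"
      using t(4) by (auto intro: order_trans)
    with Cons.prems have "lyndon_factorization (l @ s) (l # m # ms)"
      by (subst lyndon_factorization_Cons) blast
    then show ?thesis
      by blast
  qed
qed

lemma lyndon_factorization_exists:
  fixes w :: "'a::linorder list"
  shows "\<exists>ls. lyndon_factorization w ls"
proof (induction w)
  case Nil
  have "lyndon_factorization [] []"
    by simp
  then show ?case
    by blast
next
  case (Cons a w)
  have "lyndon [a]"
    by (auto simp: lyndon_def Cons_eq_append_conv)
  with Cons show ?case
    using lyndon_factorization_insert[of "[a]" w] by auto
qed

section \<open>The first Lyndon factor\<close>

lemma concat_append_le_swap:
  fixes l :: "'a::linorder list"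
  assumes "lyndon l" "\<forall>m\<in>set ls. lyndon m \<and> m \<le> l"
  shows "concat ls @ l \<le> l @ concat ls"
  using assms(2)
proof (induction ls)
  case (Cons m ms)
  have "concat (m # ms) @ l \<le> (m @ l) @ concat ms"
    using Cons by simp
  also have "(m @ l) @ concat ms \<le> (l @ m) @ concat ms"
  \<comment> \<open>The two words have equal length, so a strict inequality is decided at a letter
    and persists after appending \<open>concat ms\<close>.\<close>
  proof (cases "m @ l = l @ m")
    case False
    with Cons.prems assms(1) have "m @ l < l @ m"
      using lyndon_append_le_swap[of m l] by auto
    then have "(m @ l) @ concat ms < (l @ m) @ concat ms"
      by (rule less_imp_append_less_append) simp
    then show ?thesis
      by (rule less_imp_le)
  qed simp
  finally show ?case
    by simp
qed simp

text \<open>The condition \<open>w @ p \<le> p @ w\<close> is the common form to which both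
  conditions of the theorem reduce.\<close>

lemma shortest_prefix_hd_lyndon:
  fixes w :: "'a::linorder list"
  assumes "lyndon_factorization w (l # ls)"
  shows "shortest_prefix w (\<lambda>p s. w @ p \<le> p @ w) l"
proof -
  have l: "lyndon l" and ls: "\<forall>m\<in>set ls. lyndon m \<and> m \<le> l" and w: "w = l @ concat ls"
    using assms by (auto simp: lyndon_factorization_def)
  have "w @ l \<le> l @ w"
    using concat_append_le_swap[OF l ls] by (simp add: w)
  moreover have False
    if p: "p \<noteq> []" "w = p @ s" "w @ p \<le> p @ w" "length p < length l" for p s
  proof -
    obtain q where q: "l = p @ q" "q \<noteq> []"
      using p(2,4) w by (auto simp: append_eq_append_conv2)
    with l p(1) have "l < q"
      by (auto simp: lyndon_def)
    \<comment> \<open>Since \<open>q\<close> is shorter than \<open>l\<close>, a letter decides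
      \<open>l < q\<close>. Putting \<open>p\<close> in front turns the two sides into
      \<open>p @ w\<close> and \<open>w @ p\<close>.\<close>
    then have "l @ concat ls < q @ (concat ls @ p)"
      using q by (intro less_imp_append_less_append) auto
    then have "p @ w < w @ p"
      unfolding w by (metis q(1) append_assoc append_less_append_cancel)
    with p(3) show False
      by simp
  qed
  moreover have "l \<noteq> []"
    using l by (simp add: lyndon_def)
  ultimately show ?thesis
    unfolding shortest_prefix_def is_arg_min_def using w by blast
qed

lemma shortest_prefix_unique:
  assumes "shortest_prefix w P p" "shortest_prefix w P q"
  shows "p = q"
proof -
  have "\<not> length p < length q" "\<not> length q < length p"
    using assms unfolding shortest_prefix_def is_arg_min_def by blast+
  then have "length p = length q"
    by simp
  moreover obtain s t where "p @ s = q @ t"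
    using assms unfolding shortest_prefix_def is_arg_min_def by metis
  ultimately show ?thesis
    by simp
qed

lemma shortest_prefix_cong:
  assumes "\<And>p s. p \<noteq> [] \<Longrightarrow> w = p @ s \<Longrightarrow> P p s \<longleftrightarrow> Q p s"
  shows "shortest_prefix w P = shortest_prefix w Q"
proof -
  have "(\<lambda>p. p \<noteq> [] \<and> (\<exists>s. w = p @ s \<and> P p s)) = (\<lambda>p. p \<noteq> [] \<and> (\<exists>s. w = p @ s \<and> Q p s))"
    using assms by blast
  then show ?thesis
    by (simp add: shortest_prefix_def fun_eq_iff)
qed

lemma lyndon_factorization_unique:
  assumes "lyndon_factorization w ls" "lyndon_factorization w ms"
  shows "ls = ms"
  using assms
proof (induction ls arbitrary: w ms)
  case Nil
  then show ?case
    by (cases ms) (auto simp: lyndon_factorization_Cons lyndon_def)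
next
  case (Cons l ls)
  then have "w \<noteq> []"
    by (auto simp: lyndon_factorization_Cons lyndon_def)
  with Cons.prems(2) obtain m ms' where ms: "ms = m # ms'"
    by (cases ms) auto
  have "l = m"
    using Cons.prems unfolding ms by (blast intro: shortest_prefix_unique shortest_prefix_hd_lyndon)
  with Cons ms show ?case
    by (auto simp: lyndon_factorization_Cons)
qed

theorem theorem6:
  fixes w :: "'a::linorder list"
  assumes "w \<noteq> []"
  shows "(\<exists>!ls. lyndon_factorization w ls) \<and>
    (\<forall>ls. lyndon_factorization w ls \<longrightarrow>
      shortest_prefix w (\<lambda>p s. s = [] \<or> omega_le (s\<^sup>\<omega>) (p\<^sup>\<omega>)) (hd ls) \<and>
      shortest_prefix w (\<lambda>p s. omega_le (w\<^sup>\<omega>) (p\<^sup>\<omega>)) (hd ls))"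
proof (intro conjI allI impI)
  show "\<exists>!ls. lyndon_factorization w ls"
    using lyndon_factorization_exists lyndon_factorization_unique by blast
next
  fix ls
  assume "lyndon_factorization w ls"
  with assms have *: "shortest_prefix w (\<lambda>p s. w @ p \<le> p @ w) (hd ls)"
    \<comment> \<open>As \<open>w\<close> is nonempty, \<open>ls\<close> is nonempty and
      \<open>hd ls\<close> is a genuine factor.\<close>
    by (cases ls) (auto intro: shortest_prefix_hd_lyndon)
  have "shortest_prefix w (\<lambda>p s. s = [] \<or> omega_le (s\<^sup>\<omega>) (p\<^sup>\<omega>)) =
      shortest_prefix w (\<lambda>p s. w @ p \<le> p @ w)"
  proof (rule shortest_prefix_cong)
    fix p s
    assume "p \<noteq> []" "w = p @ s"
    then show "s = [] \<or> omega_le (s\<^sup>\<omega>) (p\<^sup>\<omega>) \<longleftrightarrow> w @ p \<le> p @ w"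
      \<comment> \<open>For empty \<open>s\<close> we have \<open>w = p\<close> and both sides are
        true; otherwise cancelling a leading \<open>p\<close> on the right leaves
        \<open>s @ p \<le> p @ s\<close>.\<close>
      by (cases "s = []") (simp_all add: omega_le_iter_iff)
  qed
  with * show "shortest_prefix w (\<lambda>p s. s = [] \<or> omega_le (s\<^sup>\<omega>) (p\<^sup>\<omega>)) (hd ls)"
    by simp
  have "shortest_prefix w (\<lambda>p s. omega_le (w\<^sup>\<omega>) (p\<^sup>\<omega>)) =
      shortest_prefix w (\<lambda>p s. w @ p \<le> p @ w)"
    using assms by (intro shortest_prefix_cong) (simp add: omega_le_iter_iff)
  with * show "shortest_prefix w (\<lambda>p s. omega_le (w\<^sup>\<omega>) (p\<^sup>\<omega>)) (hd ls)"
    by simp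
qed

end
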